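(* Let $B$ be a locale and let $X$ be a $B$-module. The following conditions are equivalent: 1. $X$ can be equipped with a structure of pre-Hilbert $B$-module for which there is a Hilbert basis; 2. $X$ can be equipped with a structure of Hilbert $B$-module for which there is a Hilbert basis; 3. $X$ is an étale $B$-locale.
   Context: A locale is a frame (complete lattice in which finite meets distribute over arbitrary joins). A $B$-module is a complete lattice $X$ with an action $B\times X\to X$, $(b,x)\mapsto bx$, preserving arbitrary joins in each variable and satisfying $1x=x$ and $(b\wedge c)x=b(cx)$. A homomorphism of $B$-modules preserves arbitrary joins and the action. A pre-Hilbert $B$-module is a $B$-module $X$ with a function $\langle-,-\rangle:X\times X\to B$ (inner product) such that $\langle bx,y\rangle=b\wedge\langle x,y\rangle$, $\langle\bigvee_\alpha x_\alpha,y\rangle=\bigvee_\alpha\langle x_\alpha,y\rangle$ and $\langle x,y\rangle=\langle y,x\rangle$ for all $x,y,x_\alpha\in X$, $b\in B$. It is a Hilbert $B$-module if moreover the inner product is non-degenerate: $\langle x,-\rangle=\langle y,-\rangle$ implies $x=y$. A Hilbert basis of a pre-Hilbert $B$-module $X$ is a subset $\mathit{\Gamma}\subset X$ such that $x=\bigvee_{s\in\mathit{\Gamma}}\langle x,s\rangle s$ for all $x\in X$. A $B$-locale is a locale $X$ equipped with a $B$-module structure such that $bx=b1\wedge x$ for all $b\in B$, $x\in X$. Its projection is the map of locales $p:X\to B$ given by the homomorphism $p^*:B\to X$, $p^*(b)=b1$. A $B$-locale is open if $p^*$ has a left adjoint $\varsigma=p_!:X\to B$ which is a homomorphism of $B$-modules.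 A local section of an open $B$-locale $X$ is an $s\in X$ such that $\varsigma(x)s=x$ for all $x\le s$; $\mathit{\Gamma}_X$ is the set of local sections. An étale $B$-locale is an open $B$-locale $X$ with $\bigvee\mathit{\Gamma}_X=1$. *)

theory Defs
  imports Main
begin

(* The library class complete_distrib_lattice demands complete distributivity,
   which is strictly stronger than the frame law. *)
class frame = complete_lattice +
  assumes inf_Sup_frame: "inf x (Sup A) = (SUP a\<in>A. inf x a)"

locale b_module =
  fixes act :: "'b::frame \<Rightarrow> 'x::complete_lattice \<Rightarrow> 'x"
  assumes act_Sup_left: "act (Sup S) x = (SUP b\<in>S. act b x)"
    and act_Sup_right: "act b (Sup A) = (SUP x\<in>A. act b x)"
    and act_top: "act top x = x"
    and act_inf: "act (inf b c) x = act b (act c x)"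

definition b_module_hom ::
    "('b::frame \<Rightarrow> 'x::complete_lattice \<Rightarrow> 'x) \<Rightarrow> ('b \<Rightarrow> 'y::complete_lattice \<Rightarrow> 'y) \<Rightarrow> ('x \<Rightarrow> 'y) \<Rightarrow> bool" where
  "b_module_hom act act' f \<longleftrightarrow>
     (\<forall>A. f (Sup A) = (SUP x\<in>A. f x)) \<and> (\<forall>b x. f (act b x) = act' b (f x))"

locale pre_hilbert_module = b_module act
  for act :: "'b::frame \<Rightarrow> 'x::complete_lattice \<Rightarrow> 'x" +
  fixes ip :: "'x \<Rightarrow> 'x \<Rightarrow> 'b"
  assumes ip_act: "ip (act b x) y = inf b (ip x y)"
    and ip_Sup: "ip (Sup A) y = (SUP x\<in>A. ip x y)"
    and ip_commute: "ip x y = ip y x"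

locale hilbert_module = pre_hilbert_module +
  assumes ip_nondegenerate: "ip x = ip y \<Longrightarrow> x = y"

definition hilbert_basis ::
    "('b \<Rightarrow> 'x::complete_lattice \<Rightarrow> 'x) \<Rightarrow> ('x \<Rightarrow> 'x \<Rightarrow> 'b) \<Rightarrow> 'x set \<Rightarrow> bool" where
  "hilbert_basis act ip \<Gamma> \<longleftrightarrow> (\<forall>x. x = (SUP s\<in>\<Gamma>. act (ip x s) s))"

locale b_locale = b_module act
  for act :: "'b::frame \<Rightarrow> 'x::complete_lattice \<Rightarrow> 'x" +
  assumes frame_law: "inf x (Sup A) = (SUP a\<in>A. inf (x::'x) a)"
    and act_eq_inf: "act b x = inf (act b top) x"

(* The inverse image part p^* of the projection p : X \<rightarrow> B. *)
definition proj :: "('b \<Rightarrow> 'x::complete_lattice \<Rightarrow> 'x) \<Rightarrow> 'b \<Rightarrow> 'x" where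
  "proj act b = act b top"

definition left_adjoint :: "('x::order \<Rightarrow> 'b::order) \<Rightarrow> ('b \<Rightarrow> 'x) \<Rightarrow> bool" where
  "left_adjoint f g \<longleftrightarrow> (\<forall>x b. f x \<le> b \<longleftrightarrow> x \<le> g b)"

(* Being a left adjoint determines \<sigma> uniquely, so carrying \<sigma> as a parameter adds no
   structure. B is a module over itself by binary meet. *)
locale open_b_locale = b_locale act
  for act :: "'b::frame \<Rightarrow> 'x::complete_lattice \<Rightarrow> 'x" +
  fixes \<sigma> :: "'x \<Rightarrow> 'b"
  assumes adjoint: "left_adjoint \<sigma> (proj act)"
    and hom: "b_module_hom act inf \<sigma>"

definition local_sections ::
    "('b \<Rightarrow> 'x::complete_lattice \<Rightarrow> 'x) \<Rightarrow> ('x \<Rightarrow> 'b) \<Rightarrow> 'x set" where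
  "local_sections act \<sigma> = {s. \<forall>x\<le>s. act (\<sigma> x) s = x}"

definition etale_b_locale :: "('b::frame \<Rightarrow> 'x::complete_lattice \<Rightarrow> 'x) \<Rightarrow> bool" where
  "etale_b_locale act \<longleftrightarrow>
     (\<exists>\<sigma>. open_b_locale act \<sigma> \<and> Sup (local_sections act \<sigma>) = top)"

end

(* For a Hilbert basis, the inequality <x,s> s \<le> x makes the coordinates <x,s> behave like
   the truth values of "s belongs to x" in a set with B-valued equality.  Hence binary
   meets are computed coordinatewise, x \<sqinter> y = SUP s. (<x,s> \<sqinter> <y,s>) s, so that X is a
   B-locale.  Its support is \<sigma> x = <x,1> and the basis vectors are local sections.
   Conversely, an etale B-locale carries the inner product <x,y> = \<sigma> (x \<sqinter> y), with the
   local sections as Hilbert basis. *)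
theory Submission
  imports Defs
begin

context b_module
begin

lemma act_mono: assumes "b \<le> c" "x \<le> y" shows "act b x \<le> act c y"
proof -
  have "act c x = sup (act b x) (act c x)"
    using act_Sup_left[of "{b, c}" x] assms(1) by (simp add: sup_absorb2)
  moreover have "act c y = sup (act c x) (act c y)"
    using act_Sup_right[of c "{x, y}"] assms(2) by (simp add: sup_absorb2)
  ultimately show ?thesis
    by (metis le_sup_iff order_refl sup.absorb_iff2)
qed

lemma act_le: "act b x \<le> x"
  using act_mono[of b top x x] by (simp add: act_top)

end

context pre_hilbert_module
begin

lemma ip_mono_left: assumes "x \<le> y" shows "ip x z \<le> ip y z"
  using ip_Sup[of "{x, y}" z] assms by (simp add: sup_absorb2 le_iff_sup)

lemma ip_mono: "x \<le> y \<Longrightarrow> z \<le> w \<Longrightarrow> ip x z \<le> ip y w"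
  by (metis ip_mono_left ip_commute order_trans)

end

locale hilbert_basis_module = pre_hilbert_module act ip
  for act :: "'b::frame \<Rightarrow> 'x::complete_lattice \<Rightarrow> 'x" and ip +
  fixes \<Gamma> :: "'x set"
  assumes basis: "hilbert_basis act ip \<Gamma>"
begin

lemma expansion: "(SUP s\<in>\<Gamma>. act (ip x s) s) = x"
  using basis unfolding hilbert_basis_def by simp

text \<open>The expansion rebuilds x from the function \<open>ip x\<close> alone, so any inner
  product with a Hilbert basis already makes the module Hilbert.\<close>

lemma nondegenerate: assumes "ip x = ip y" shows "x = y"
  by (metis expansion assms)

lemma act_ip_le: "s \<in> \<Gamma> \<Longrightarrow> act (ip x s) s \<le> x"
  using SUP_upper[of s \<Gamma> "\<lambda>s. act (ip x s) s"] by (simp add: expansion)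

text \<open>Pairing the inequality of \<open>act_ip_le\<close> with y gives this transitivity of the
  B-valued equality. The middle element must be a basis vector.\<close>

lemma ip_trans: assumes "s \<in> \<Gamma>" shows "inf (ip x s) (ip s y) \<le> ip x y"
  using ip_mono_left[OF act_ip_le[OF assms]] by (simp add: ip_act)

text \<open>For \<le>, expand the meet itself and bound its coordinates by monotonicity; for the
  converse, \<open>act_ip_le\<close> puts every term below both x and y.\<close>

lemma inf_expansion: "inf x y = (SUP s\<in>\<Gamma>. act (inf (ip x s) (ip y s)) s)"
proof (rule antisym)
  have "(SUP s\<in>\<Gamma>. act (ip (inf x y) s) s) \<le> (SUP s\<in>\<Gamma>. act (inf (ip x s) (ip y s)) s)"
    by (intro SUP_mono' act_mono le_infI ip_mono_left) simp_all
  then show "inf x y \<le> (SUP s\<in>\<Gamma>. act (inf (ip x s) (ip y s)) s)"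
    by (simp add: expansion)
  show "(SUP s\<in>\<Gamma>. act (inf (ip x s) (ip y s)) s) \<le> inf x y"
  proof (rule SUP_least)
    fix s assume "s \<in> \<Gamma>"
    then show "act (inf (ip x s) (ip y s)) s \<le> inf x y"
      by (meson act_ip_le act_mono inf_le1 inf_le2 le_infI order_refl order_trans)
  qed
qed

text \<open>In coordinates the claim becomes the frame law of B, after which the two suprema are
  exchanged.\<close>

lemma inf_Sup_distrib: "inf x (Sup A) = (SUP a\<in>A. inf (x::'x) a)"
proof -
  have "inf x (Sup A) = (SUP s\<in>\<Gamma>. SUP a\<in>A. act (inf (ip x s) (ip a s)) s)"
    unfolding inf_expansion ip_Sup inf_Sup_frame act_Sup_left by (simp add: image_image)
  also have "\<dots> = (SUP a\<in>A. inf x a)"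
    unfolding inf_expansion by (rule SUP_commute)
  finally show ?thesis .
qed

text \<open>The scalar b factors out of each coordinate of \<open>act b top\<close>, hence out of
  the whole expansion of the meet.\<close>

lemma act_eq_inf_act_top: "act b x = inf (act b top) x"
proof -
  have "inf (act b top) x = (SUP s\<in>\<Gamma>. act b (act (inf (ip top s) (ip x s)) s))"
    by (simp add: inf_expansion ip_act inf_assoc act_inf)
  also have "\<dots> = act b (SUP s\<in>\<Gamma>. act (inf (ip top s) (ip x s)) s)"
    by (simp add: act_Sup_right image_image)
  also have "\<dots> = act b (inf top x)"
    by (simp only: inf_expansion)
  finally show ?thesis by simp
qed

text \<open>This is the unit of the adjunction between support and \<open>proj act\<close>: in the
  expansion of x, both the coefficients and the vectors are enlarged by replacing s with
  \<open>top\<close>.\<close>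

lemma le_act_ip_top: "x \<le> act (ip x top) top"
proof -
  have "(SUP s\<in>\<Gamma>. act (ip x s) s) \<le> act (ip x top) top"
    by (intro SUP_least act_mono ip_mono) simp_all
  then show ?thesis by (simp add: expansion)
qed

lemma left_adjoint_ip_top: "left_adjoint (\<lambda>x. ip x top) (proj act)"
  unfolding left_adjoint_def proj_def
proof (intro allI iffI)
  fix x b
  assume "ip x top \<le> b"
  then show "x \<le> act b top"
    using le_act_ip_top act_mono order_trans by blast
next
  fix x b
  assume "x \<le> act b top"
  from ip_mono_left[OF this, of top] show "ip x top \<le> b"
    by (simp add: ip_act)
qed

sublocale support: open_b_locale act "\<lambda>x. ip x top"
  by unfold_locales
    (simp_all add: inf_Sup_distrib left_adjoint_ip_top b_module_hom_def ip_Sup ip_act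
      flip: act_eq_inf_act_top)

lemma basis_local_section:
  assumes "s \<in> \<Gamma>" shows "s \<in> local_sections act (\<lambda>x. ip x top)"
  unfolding local_sections_def
proof (intro CollectI allI impI antisym)
  fix x assume "x \<le> s"
  then show "x \<le> act (ip x top) s"
    using le_act_ip_top by (simp add: act_eq_inf_act_top[of _ s])
  \<comment> \<open>Two uses of \<open>ip_trans\<close>, through s and then through t, lead from r
    back to x; the link between t and s comes from x \<le> s.\<close>
  have *: "inf (ip x t) (ip s r) \<le> ip x r" if "t \<in> \<Gamma>" for t r
  proof -
    have "ip x t \<le> ip t s"
      using ip_mono_left[OF \<open>x \<le> s\<close>] by (simp add: ip_commute[of t])
    then have "inf (ip x t) (ip s r) \<le> inf (ip x t) (inf (ip t s) (ip s r))"
      by (simp add: le_infI1)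
    also have "\<dots> \<le> inf (ip x t) (ip t r)"
      using ip_trans[OF assms] by (rule inf_mono[OF order_refl])
    also have "\<dots> \<le> ip x r"
      using that by (rule ip_trans)
    finally show ?thesis .
  qed
  have "act (ip x t) s \<le> x" if "t \<in> \<Gamma>" for t
  proof -
    have "act (ip x t) (SUP r\<in>\<Gamma>. act (ip s r) r) = (SUP r\<in>\<Gamma>. act (inf (ip x t) (ip s r)) r)"
      by (simp add: act_Sup_right image_image act_inf)
    also have "\<dots> \<le> (SUP r\<in>\<Gamma>. act (ip x r) r)"
      using *[OF that] by (intro SUP_mono' act_mono) simp_all
    finally show ?thesis by (simp add: expansion)
  qed
  \<comment> \<open>Expanding \<open>top\<close> rather than x shows that the coordinates of x cover
    its support, which reduces the goal to the bound just proved for each t.\<close>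
  moreover have "ip x top \<le> (SUP t\<in>\<Gamma>. ip x t)"
  proof -
    have "ip (SUP t\<in>\<Gamma>. act (ip top t) t) x = (SUP t\<in>\<Gamma>. inf (ip top t) (ip t x))"
      by (simp add: ip_Sup image_image ip_act)
    also have "\<dots> \<le> (SUP t\<in>\<Gamma>. ip x t)"
      by (intro SUP_mono') (simp add: ip_commute[of x])
    finally show ?thesis by (simp add: expansion ip_commute[of x])
  qed
  then have "act (ip x top) s \<le> (SUP t\<in>\<Gamma>. act (ip x t) s)"
    using act_mono[OF _ order_refl[of s]] by (fastforce simp: act_Sup_left image_image)
  ultimately show "act (ip x top) s \<le> x"
    by (meson SUP_least order_trans)
qed

lemma Sup_basis: "Sup \<Gamma> = top"
proof -
  have "(SUP s\<in>\<Gamma>. act (ip top s) s) \<le> Sup \<Gamma>"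
    by (meson SUP_least Sup_upper act_le order_trans)
  then show ?thesis by (simp add: expansion top_unique)
qed

lemma etale: "etale_b_locale act"
proof -
  have "Sup \<Gamma> \<le> Sup (local_sections act (\<lambda>x. ip x top))"
    using basis_local_section by (intro Sup_subset_mono subsetI)
  then show ?thesis
    unfolding etale_b_locale_def using support.open_b_locale_axioms
    by (metis Sup_basis top_unique)
qed

end

context open_b_locale
begin

text \<open>Since scalars act by meeting with \<open>act b top\<close>, they pass through binary
  meets by associativity; \<open>hom\<close> and the frame law then give linearity.\<close>

lemma pre_hilbert_module_support: "pre_hilbert_module act (\<lambda>x y. \<sigma> (inf x y))"
proof unfold_locales
  have \<sigma>_Sup: "\<sigma> (Sup A) = (SUP x\<in>A. \<sigma> x)" and \<sigma>_act: "\<sigma> (act b x) = inf b (\<sigma> x)" for A b x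
    using hom unfolding b_module_hom_def by auto
  show "\<sigma> (inf (act b x) y) = inf b (\<sigma> (inf x y))" for b x y
    by (metis act_eq_inf inf_assoc \<sigma>_act)
  show "\<sigma> (inf (Sup A) y) = (SUP x\<in>A. \<sigma> (inf x y))" for A y
    by (simp add: inf_commute[of _ y] frame_law \<sigma>_Sup image_image)
  show "\<sigma> (inf x y) = \<sigma> (inf y x)" for x y
    by (simp add: inf_commute)
qed

text \<open>As \<open>inf x s\<close> lies below the local section s, its support restricts s to
  exactly \<open>inf x s\<close>. The frame law then sums these pieces to the meet of x with
  \<open>top\<close>.\<close>

lemma hilbert_basis_local_sections:
  assumes "Sup (local_sections act \<sigma>) = top"
  shows "hilbert_basis act (\<lambda>x y. \<sigma> (inf x y)) (local_sections act \<sigma>)"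
  unfolding hilbert_basis_def
proof
  fix x
  have "(SUP s\<in>local_sections act \<sigma>. act (\<sigma> (inf x s)) s) = (SUP s\<in>local_sections act \<sigma>. inf x s)"
    by (intro SUP_cong) (auto simp: local_sections_def)
  also have "\<dots> = x"
    using frame_law[of x "local_sections act \<sigma>"] assms by simp
  finally show "x = (SUP s\<in>local_sections act \<sigma>. act (\<sigma> (inf x s)) s)" ..
qed

end

theorem theorem3p15:
  fixes act :: "'b::frame \<Rightarrow> 'x::complete_lattice \<Rightarrow> 'x"
  assumes "b_module act"
  shows "((\<exists>ip. pre_hilbert_module act ip \<and> (\<exists>\<Gamma>. hilbert_basis act ip \<Gamma>))
           \<longleftrightarrow> (\<exists>ip. hilbert_module act ip \<and> (\<exists>\<Gamma>. hilbert_basis act ip \<Gamma>)))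
       \<and> ((\<exists>ip. hilbert_module act ip \<and> (\<exists>\<Gamma>. hilbert_basis act ip \<Gamma>))
           \<longleftrightarrow> etale_b_locale act)"
proof -
  have hilbert: "hilbert_module act ip" if "pre_hilbert_module act ip" "hilbert_basis act ip \<Gamma>"
    for ip \<Gamma>
    using hilbert_basis_module.nondegenerate hilbert_basis_module.intro
      hilbert_basis_module_axioms.intro hilbert_module.intro hilbert_module_axioms.intro that
    by metis
  have pre: "pre_hilbert_module act ip" if "hilbert_module act ip" for ip
    using that by (rule hilbert_module.axioms)
  have "etale_b_locale act" if "pre_hilbert_module act ip" "hilbert_basis act ip \<Gamma>" for ip \<Gamma>
    using that hilbert_basis_module.etale hilbert_basis_module.intro
      hilbert_basis_module_axioms.intro by metis
  moreover have "\<exists>ip. pre_hilbert_module act ip \<and> (\<exists>\<Gamma>. hilbert_basis act ip \<Gamma>)"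
    if "etale_b_locale act"
    using that unfolding etale_b_locale_def
    by (meson open_b_locale.pre_hilbert_module_support open_b_locale.hilbert_basis_local_sections)
  \<comment> \<open>The pre-Hilbert condition is the hub: it implies the Hilbert condition with the
    same \<open>ip\<close> and \<open>\<Gamma>\<close>, and it is linked to the etale condition in
    both directions.\<close>
  ultimately show ?thesis
    using hilbert pre by blast
qed

end
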